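(* Let $J=(J_{i,j})$ be a real symmetric $n\times n$ matrix with zero diagonal and largest eigenvalue $\lambda'_{\max}$, and let $K,\Delta,\xi_0>0$ be constants. For a parameter $p>0$ let $$H_s(x,y)=\sum_{i=1}^n\frac\Delta2y_i^2+U_h(x),\qquad U_h(x)=\sum_{i=1}^n\left(\frac K4x_i^4+\frac{\Delta-p}{2}x_i^2\right)-\frac{\xi_0}{2}x^TJx,\quad x,y\in\mathbb{R}^n.$$ There is an admissible threshold $\alpha_*>0$ for $(\beta,S)=(\Delta,\xi_0J)$ (see context) such that whenever $p>\max\{\alpha_*^2,\lambda'_{\max}\}$: (1) if $(x,y)\in\mathcal{C}(H_s)$, then $y=0$; (2) the map $\pi_s:\mathcal{C}(H_s)\to\mathcal{C}(U_h)$, $(x,y)\mapsto x$, is a well-defined bijection and $i_{H_s}((x,y))=i_{U_h}(x)$ for every $(x,y)\in\mathcal{C}(H_s)$; (3) if $(x,y)$ is a global minimum point of $H_s$, then $\operatorname{sgn}(x)$ minimizes the Ising energy $E(v)=-\frac12v^TJv$ over $v\in\{-1,1\}^n$.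
   Context: $\mathcal{C}(f)$ is the set of critical points of $f$ and $i_f(z)$ the Morse index of $f$ at the critical point $z$ (number of negative eigenvalues of the Hessian, with multiplicity). $\operatorname{sgn}$ is the componentwise sign. For $\beta>0$ and $S$ real symmetric with zero diagonal, a constant $\alpha_*>0$ is an admissible threshold for $(\beta,S)$ if for every $\alpha>\alpha_*$ the function $U(x)=\sum_{i=1}^n\frac14x_i^4+\frac{\beta-\alpha^2}{2}x^Tx-\frac12x^TSx$ on $\mathbb{R}^n$ has the properties: the signum vectors of its local minimum points form the set $\{-1,1\}^n$, and the signum vector of every global minimum point minimizes $-\frac12v^TSv$ over $\{-1,1\}^n$. Here $p$ is treated as a constant parameter. *)

theory Defs
  imports "HOL-Analysis.Analysis"
begin

subsection \<open>Critical points and Morse index\<close>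

definition gradient :: "('a::euclidean_space \<Rightarrow> real) \<Rightarrow> 'a \<Rightarrow> 'a" where
  "gradient f z = (THE D. GDERIV f z :> D)"

text \<open>The Hessian as a linear operator: the derivative of the gradient field. Its matrix in
  the standard basis is the matrix of second partial derivatives.\<close>

definition hessian :: "('a::euclidean_space \<Rightarrow> real) \<Rightarrow> 'a \<Rightarrow> 'a \<Rightarrow> 'a" where
  "hessian f z = frechet_derivative (gradient f) (at z)"

definition critical_points :: "('a::euclidean_space \<Rightarrow> real) \<Rightarrow> 'a set" where
  "critical_points f = {z. GDERIV f z :> 0}"

definition eigenspace :: "('a::real_vector \<Rightarrow> 'a) \<Rightarrow> real \<Rightarrow> 'a set" where
  "eigenspace L \<mu> = {v. L v = \<mu> *\<^sub>R v}"

definition eigenvalues :: "('a::real_vector \<Rightarrow> 'a) \<Rightarrow> real set" where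
  "eigenvalues L = {\<mu>. \<exists>v. v \<noteq> 0 \<and> L v = \<mu> *\<^sub>R v}"

text \<open>The multiplicity of an eigenvalue is the dimension of its eigenspace. The Hessian of a
  smooth function is self-adjoint, so there is no difference to the algebraic multiplicity.\<close>

definition morse_index :: "('a::euclidean_space \<Rightarrow> real) \<Rightarrow> 'a \<Rightarrow> nat" where
  "morse_index f z =
     (\<Sum>\<mu> | \<mu> \<in> eigenvalues (hessian f z) \<and> \<mu> < 0. dim (eigenspace (hessian f z) \<mu>))"

subsection \<open>Minimum points, signum vectors and the Ising energy\<close>

definition local_min_point :: "('a::topological_space \<Rightarrow> real) \<Rightarrow> 'a \<Rightarrow> bool" where
  "local_min_point f z \<longleftrightarrow> (\<forall>\<^sub>F w in nhds z. f z \<le> f w)"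

abbreviation global_min_point :: "('a \<Rightarrow> real) \<Rightarrow> 'a \<Rightarrow> bool" where
  "global_min_point f z \<equiv> is_arg_min f (\<lambda>_. True) z"

text \<open>Componentwise sign; the overloaded \<^const>\<open>sgn\<close> on vectors is normalization instead.\<close>

definition sgn_vec :: "real ^ 'n \<Rightarrow> real ^ 'n" where
  "sgn_vec x = (\<chi> i. sgn (x $ i))"

definition spins :: "(real ^ 'n) set" where
  "spins = {v. \<forall>i. v $ i \<in> {-1, 1}}"

definition ising_energy :: "real ^ 'n ^ 'n \<Rightarrow> real ^ 'n \<Rightarrow> real" where
  "ising_energy S v = - (1 / 2) * (v \<bullet> (S *v v))"

subsection \<open>The potentials\<close>

definition quartic_potential :: "real \<Rightarrow> real \<Rightarrow> real ^ 'n ^ 'n \<Rightarrow> real ^ 'n \<Rightarrow> real" where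
  "quartic_potential \<alpha> \<beta> S x =
     (\<Sum>i\<in>UNIV. 1 / 4 * (x $ i) ^ 4) + (\<beta> - \<alpha>\<^sup>2) / 2 * (x \<bullet> x) - 1 / 2 * (x \<bullet> (S *v x))"

definition admissible_threshold :: "real \<Rightarrow> real ^ 'n ^ 'n \<Rightarrow> real \<Rightarrow> bool" where
  "admissible_threshold \<beta> S \<alpha>\<^sub>0 \<longleftrightarrow> \<alpha>\<^sub>0 > 0 \<and>
     (\<forall>\<alpha>>\<alpha>\<^sub>0.
        sgn_vec ` {x. local_min_point (quartic_potential \<alpha> \<beta> S) x} = spins \<and>
        (\<forall>x. global_min_point (quartic_potential \<alpha> \<beta> S) x \<longrightarrow>
           is_arg_min (ising_energy S) (\<lambda>v. v \<in> spins) (sgn_vec x)))"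

definition U_h :: "real \<Rightarrow> real \<Rightarrow> real \<Rightarrow> real ^ 'n ^ 'n \<Rightarrow> real \<Rightarrow> real ^ 'n \<Rightarrow> real" where
  "U_h K \<Delta> \<xi>\<^sub>0 J p x =
     (\<Sum>i\<in>UNIV. K / 4 * (x $ i) ^ 4 + (\<Delta> - p) / 2 * (x $ i)\<^sup>2) - \<xi>\<^sub>0 / 2 * (x \<bullet> (J *v x))"

definition H_s ::
    "real \<Rightarrow> real \<Rightarrow> real \<Rightarrow> real ^ 'n ^ 'n \<Rightarrow> real \<Rightarrow> (real ^ 'n) \<times> (real ^ 'n) \<Rightarrow> real" where
  "H_s K \<Delta> \<xi>\<^sub>0 J p = (\<lambda>(x, y). (\<Sum>i\<in>UNIV. \<Delta> / 2 * (y $ i)\<^sup>2) + U_h K \<Delta> \<xi>\<^sub>0 J p x)"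

end

theory Submission
  imports Defs "HOL-Real_Asymp.Real_Asymp"
begin

text \<open>With \<open>a = \<alpha>\<^sup>2 - \<beta>\<close>, completing the square turns the potential into a sum of double wells
  \<open>(x\<^sub>i\<^sup>2 - a)\<^sup>2 / 4\<close> plus the quadratic coupling. A local minimum has no zero component, because the
  second difference in that direction would be negative (the coupling has zero diagonal). Below
  the level of a scaled spin vector \<open>sqrt a *\<^sub>R v\<close> all \<open>(x\<^sub>i\<^sup>2 - a)\<^sup>2\<close> are \<open>O(a)\<close>, hence smaller than
  \<open>a\<^sup>2\<close> for large \<open>a\<close>: the minimum over each closed orthant is interior. A global minimum is
  therefore at bounded distance from \<open>sqrt a\<close> times its sign vector, and its coupling energy is \<open>a\<close> times
  the Ising energy up to \<open>O(sqrt a)\<close>; as there are finitely many spin vectors, the Ising energy of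
  the sign vector must be minimal for large \<open>a\<close>.

  Adding a positive definite quadratic form in new variables changes neither the critical points
  (up to the zero component) nor the negative eigenspaces of the Hessian, and \<open>x \<mapsto> sqrt K *\<^sub>R x\<close>
  carries \<open>U_h\<close> to the quartic potential up to a positive factor.\<close>

subsection \<open>Sign vectors of minima of the coupled double wells\<close>

definition double_well :: "real \<Rightarrow> real ^ 'n ^ 'n \<Rightarrow> real ^ 'n \<Rightarrow> real" where
  "double_well a S x = 1 / 4 * (\<Sum>i\<in>UNIV. ((x $ i)\<^sup>2 - a)\<^sup>2) - 1 / 2 * (x \<bullet> (S *v x))"

text \<open>Completing the square costs only a term independent of \<open>x\<close>, so both
  functions have the same local and global minimum points.\<close>

lemma quartic_potential_eq_double_well:
  fixes S :: "real ^ 'n ^ 'n"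
  shows "quartic_potential \<alpha> \<beta> S x =
    double_well (\<alpha>\<^sup>2 - \<beta>) S x - real CARD('n) * (\<alpha>\<^sup>2 - \<beta>)\<^sup>2 / 4"
proof -
  define a where "a = \<alpha>\<^sup>2 - \<beta>"
  have "(\<Sum>i\<in>UNIV. ((x $ i)\<^sup>2 - a)\<^sup>2)
      = (\<Sum>i\<in>UNIV. (x $ i) ^ 4 - 2 * a * (x $ i)\<^sup>2 + a\<^sup>2)"
    by (intro sum.cong refl) (simp add: power2_eq_square power4_eq_xxxx algebra_simps)
  also have "\<dots> = (\<Sum>i\<in>UNIV. (x $ i) ^ 4) - 2 * a * (x \<bullet> x) + real CARD('n) * a\<^sup>2"
    by (simp add: sum.distrib sum_subtractf inner_vec_def power2_eq_square sum_distrib_left)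
  finally have "double_well a S x = 1 / 4 * (\<Sum>i\<in>UNIV. (x $ i) ^ 4) + (- a) / 2 * (x \<bullet> x)
      + real CARD('n) * a\<^sup>2 / 4 - 1 / 2 * (x \<bullet> (S *v x))"
    by (simp add: double_well_def algebra_simps)
  moreover have "\<beta> - \<alpha>\<^sup>2 = - a"
    by (simp add: a_def)
  ultimately show ?thesis
    unfolding quartic_potential_def a_def[symmetric] by (simp add: sum_distrib_left)
qed

lemma power2_norm_vec:
  fixes x :: "real ^ 'n"
  shows "(norm x)\<^sup>2 = (\<Sum>i\<in>UNIV. (x $ i)\<^sup>2)"
  by (simp add: norm_vec_def L2_set_def sum_nonneg)

lemma continuous_on_double_well: "continuous_on A (double_well a S)"
  unfolding double_well_def[abs_def]
  by (intro continuous_intros linear_continuous_on matrix_vector_mul_bounded_linear)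

lemma local_min_double_well_nonzero:
  fixes S :: "real ^ 'n ^ 'n"
  assumes "local_min_point (double_well a S) x" and "a > 0" and diag: "S $ k $ k = 0"
  shows "x $ k \<noteq> 0"
proof
  assume x0: "x $ k = 0"
  define e :: "real ^ 'n" where "e = axis k 1"
  have ev: "\<forall>\<^sub>F t in at (0::real). double_well a S x \<le> double_well a S (x + (c * t) *\<^sub>R e)" for c
  proof -
    have "((\<lambda>t. x + (c * t) *\<^sub>R e) \<longlongrightarrow> x + (c * 0) *\<^sub>R e) (at 0)"
      by (intro tendsto_intros)
    then have "filterlim (\<lambda>t. x + (c * t) *\<^sub>R e) (nhds x) (at 0)" by simp
    then show ?thesis
      using assms(1) unfolding local_min_point_def by (rule eventually_compose_filterlim[rotated])
  qed
  \<comment> \<open>For \<open>t \<noteq> 0\<close> this is the range in which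
    \<open>t\<^sup>2 * (t\<^sup>2 - 2 * a)\<close> is negative.\<close>
  have "\<forall>\<^sub>F t in at (0::real). t\<^sup>2 < 2 * a"
    using \<open>a > 0\<close> by real_asymp
  moreover have "\<forall>\<^sub>F t in at (0::real). t \<noteq> 0"
    by (simp add: eventually_at_filter)
  ultimately have "\<forall>\<^sub>F t in at (0::real). t \<noteq> 0 \<and> t\<^sup>2 < 2 * a
      \<and> double_well a S x \<le> double_well a S (x + (1 * t) *\<^sub>R e)
      \<and> double_well a S x \<le> double_well a S (x + (-1 * t) *\<^sub>R e)"
    using ev[of 1] ev[of "-1"] by eventually_elim blast
  then obtain t where t: "t \<noteq> 0" "t\<^sup>2 < 2 * a"
      "double_well a S x \<le> double_well a S (x + t *\<^sub>R e)"
      "double_well a S x \<le> double_well a S (x + (- t) *\<^sub>R e)"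
    by (auto dest!: eventually_happens)
  have *: "(\<Sum>i\<in>UNIV. (((x + s *\<^sub>R e) $ i)\<^sup>2 - a)\<^sup>2)
      = (\<Sum>i\<in>UNIV. ((x $ i)\<^sup>2 - a)\<^sup>2) + ((s\<^sup>2 - a)\<^sup>2 - a\<^sup>2)" for s
  proof -
    have "(\<Sum>i\<in>UNIV. (((x + s *\<^sub>R e) $ i)\<^sup>2 - a)\<^sup>2)
      = (\<Sum>i\<in>UNIV. ((x $ i)\<^sup>2 - a)\<^sup>2 + (if i = k then (s\<^sup>2 - a)\<^sup>2 - a\<^sup>2 else 0))"
      by (intro sum.cong refl) (auto simp: e_def axis_def x0)
    then show ?thesis by (simp add: sum.distrib)
  qed
  \<comment> \<open>The zero diagonal removes the term quadratic in \<open>s\<close>, so the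
    coupling is affine along this axis.\<close>
  have "e \<bullet> (S *v e) = 0"
    by (simp add: e_def inner_axis' matrix_vector_mult_basis column_def diag)
  then have **: "(x + s *\<^sub>R e) \<bullet> (S *v (x + s *\<^sub>R e))
      = x \<bullet> (S *v x) + s * (x \<bullet> (S *v e) + e \<bullet> (S *v x))" for s
    by (simp add: algebra_simps matrix_vector_right_distrib matrix_vector_mult_scaleR inner_add_left inner_add_right)
  \<comment> \<open>Adding the inequalities for \<open>t\<close> and \<open>- t\<close> cancels the
    linear coupling term.\<close>
  have "2 * (1/4 * ((t\<^sup>2 - a)\<^sup>2 - a\<^sup>2)) \<ge> 0"
    using t(3,4) unfolding double_well_def * ** by (simp add: algebra_simps)
  then have "t\<^sup>2 * (t\<^sup>2 - 2 * a) \<ge> 0" by (simp add: power2_eq_square algebra_simps)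
  with t(1,2) show False by (simp add: zero_le_mult_iff)
qed

section \<open>Coupling estimate, spin vectors and sublevel sets\<close>

lemma matrix_quadratic_form_bound:
  fixes S :: "real ^ 'n ^ 'm"
  obtains C where "C > 0" "\<And>x y. \<bar>x \<bullet> (S *v y)\<bar> \<le> C * norm x * norm y"
proof -
  obtain C where C: "C > 0" "\<And>y. norm (S *v y) \<le> norm y * C"
    using bounded_linear.pos_bounded[OF matrix_vector_mul_bounded_linear[of S]] by auto
  have "\<bar>x \<bullet> (S *v y)\<bar> \<le> C * norm x * norm y" for x y
  proof -
    have "\<bar>x \<bullet> (S *v y)\<bar> \<le> norm x * norm (S *v y)" by (rule Cauchy_Schwarz_ineq2)
    also have "\<dots> \<le> norm x * (norm y * C)" by (intro mult_left_mono C) auto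
    finally show ?thesis by (simp add: mult_ac)
  qed
  with C(1) show ?thesis using that by blast
qed

lemma spins_sq: "v \<in> spins \<Longrightarrow> (v $ i)\<^sup>2 = 1"
  by (auto simp: spins_def power2_eq_1_iff dest: spec[of _ i])

lemma norm_spins:
  fixes v :: "real ^ 'n"
  assumes "v \<in> spins" shows "(norm v)\<^sup>2 = real CARD('n)"
  using spins_sq[OF assms]
  by (simp add: power2_norm_vec)

lemma finite_spins: "finite (spins :: (real ^ 'n) set)"
proof -
  have "spins \<subseteq> vec_lambda ` ((UNIV :: 'n set) \<rightarrow>\<^sub>E {-1, 1::real})"
  proof
    fix v :: "real ^ 'n" assume "v \<in> spins"
    then have "vec_nth v \<in> UNIV \<rightarrow>\<^sub>E {-1, 1}" by (auto simp: spins_def)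
    then show "v \<in> vec_lambda ` ((UNIV :: 'n set) \<rightarrow>\<^sub>E {-1, 1::real})"
      by (metis image_eqI vec_nth_inverse)
  qed
  then show ?thesis by (rule finite_subset) (intro finite_imageI finite_PiE, auto)
qed

lemma double_well_scaled_spin:
  assumes "v \<in> spins" and "a \<ge> 0"
  shows "double_well a S (sqrt a *\<^sub>R v) = - (a / 2) * (v \<bullet> (S *v v))"
  using spins_sq[OF assms(1)] assms(2)
  by (simp add: double_well_def power_mult_distrib matrix_vector_mult_scaleR)

text \<open>In terms of \<open>w i = (x $ i)\<^sup>2 - a\<close>, the coupling is at most linear in
  the sum of the \<open>w i\<close> plus a multiple of \<open>a\<close>, while the wells are
  quadratic in \<open>w i\<close>; Young's inequality absorbs the linear part.\<close>

lemma double_well_sublevel_bound: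
  fixes S :: "real ^ 'n ^ 'n"
  assumes C: "C > 0" "\<And>x y. \<bar>x \<bullet> (S *v y)\<bar> \<le> C * norm x * norm y"
    and "a \<ge> C" and v: "v \<in> spins"
    and le: "double_well a S x \<le> double_well a S (sqrt a *\<^sub>R v)"
  shows "(\<Sum>i\<in>UNIV. ((x $ i)\<^sup>2 - a)\<^sup>2) \<le> 12 * C * real CARD('n) * a"
proof -
  let ?n = "real CARD('n)"
  define w where "w i = (x $ i)\<^sup>2 - a" for i
  have a: "a > 0" using assms by linarith
  have xx: "C * (norm x)\<^sup>2 = C * (\<Sum>i\<in>UNIV. w i) + C * ?n * a"
    by (simp add: w_def power2_norm_vec sum_subtractf algebra_simps)
  have "x \<bullet> (S *v x) \<le> C * (norm x)\<^sup>2"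
    using C(2)[of x x] by (simp add: power2_eq_square mult_ac)
  moreover have "- (v \<bullet> (S *v v)) \<le> C * ?n"
    using C(2)[of v v] norm_spins[OF v] by (simp add: power2_eq_square mult_ac)
  then have "a * (- (v \<bullet> (S *v v))) \<le> a * (C * ?n)"
    using a by (intro mult_left_mono) auto
  moreover have "1 / 4 * (\<Sum>i\<in>UNIV. (w i)\<^sup>2) \<le> 1 / 2 * (x \<bullet> (S *v x)) - a / 2 * (v \<bullet> (S *v v))"
    using le a unfolding double_well_scaled_spin[OF v less_imp_le[OF a]]
    by (simp add: double_well_def w_def)
  \<comment> \<open>Half of \<open>C * ?n * a\<close> comes from \<open>norm x\<close>, half from
    the coupling energy of \<open>v\<close>.\<close>
  ultimately have 1: "1 / 4 * (\<Sum>i\<in>UNIV. (w i)\<^sup>2) \<le> C / 2 * (\<Sum>i\<in>UNIV. w i) + C * ?n * a"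
    using xx by (simp add: algebra_simps)
  have "C / 2 * (\<Sum>i\<in>UNIV. w i) = (\<Sum>i\<in>UNIV. C / 2 * w i)" by (rule sum_distrib_left)
  \<comment> \<open>Young's inequality, weighted so that only half of the well energy
    \<open>1 / 4 * (w i)\<^sup>2\<close> is spent.\<close>
  also have "\<dots> \<le> (\<Sum>i\<in>UNIV. 1 / 8 * (w i)\<^sup>2 + C\<^sup>2 / 2)"
  proof (intro sum_mono)
    fix i show "C / 2 * w i \<le> 1 / 8 * (w i)\<^sup>2 + C\<^sup>2 / 2"
      using zero_le_power2[of "w i - 2 * C"] by (simp add: power2_eq_square algebra_simps)
  qed
  also have "\<dots> = 1 / 8 * (\<Sum>i\<in>UNIV. (w i)\<^sup>2) + ?n * C\<^sup>2 / 2"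
    by (simp add: sum.distrib sum_distrib_left sum_divide_distrib)
  finally have "(\<Sum>i\<in>UNIV. (w i)\<^sup>2) \<le> 4 * (?n * C\<^sup>2) + 8 * (C * ?n * a)"
    using 1 by simp
  \<comment> \<open>Here \<open>C \<le> a\<close> merges the coefficients 4 and 8 into 12.\<close>
  also have "?n * C\<^sup>2 \<le> ?n * (C * a)"
    using assms(1,3) by (intro mult_left_mono) (auto simp: power2_eq_square)
  finally show ?thesis by (simp add: w_def algebra_simps)
qed

text \<open>The part of the closed orthant of \<open>v\<close> below the level of
  \<open>sqrt a *\<^sub>R v\<close> is compact. The bound on \<open>a\<close> keeps the sublevel
  estimate below \<open>a\<^sup>2\<close>, the value of \<open>((x $ i)\<^sup>2 - a)\<^sup>2\<close>
  at \<open>x $ i = 0\<close>, so a minimizer lies in the open orthant.\<close>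

lemma double_well_orthant_minimum:
  fixes S :: "real ^ 'n ^ 'n"
  assumes C: "C > 0" "\<And>x y. \<bar>x \<bullet> (S *v y)\<bar> \<le> C * norm x * norm y"
    and a: "a > 12 * C * real CARD('n)" and v: "v \<in> spins"
  shows "\<exists>x. local_min_point (double_well a S) x \<and> sgn_vec x = v"
proof -
  let ?n = "real CARD('n)"
  have n1: "?n \<ge> 1" using zero_less_card_finite[where 'a='n] by linarith
  have "C * 1 \<le> C * ?n" using n1 C(1) by (intro mult_left_mono) auto
  then have aC: "a \<ge> C" using a C(1) by linarith
  have a0: "a > 0" using aC C(1) by linarith
  define Q where "Q = {x. (\<forall>i. v $ i * x $ i \<ge> 0) \<and> double_well a S x \<le> double_well a S (sqrt a *\<^sub>R v)}"
  have comp: "((x $ i)\<^sup>2 - a)\<^sup>2 \<le> 12 * C * ?n * a" if "x \<in> Q" for x i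
  proof -
    have "((x $ i)\<^sup>2 - a)\<^sup>2 \<le> (\<Sum>i\<in>UNIV. ((x $ i)\<^sup>2 - a)\<^sup>2)"
      by (intro member_le_sum) auto
    with double_well_sublevel_bound[OF C aC v, of x] that show ?thesis by (auto simp: Q_def)
  qed
  have less: "12 * C * ?n * a < a\<^sup>2"
    using a a0 by (simp add: power2_eq_square)
  have "closed Q"
    unfolding Q_def
    by (intro closed_Collect_conj closed_Collect_all closed_Collect_le continuous_intros
        continuous_on_double_well)
  moreover have "bounded Q"
  proof (rule boundedI)
    fix x assume x: "x \<in> Q"
    \<comment> \<open>From \<open>(x $ i)\<^sup>2 \<le> 2 * a\<close>, the inequality 2 r \<le> r^2
      + 1 gives a crude bound free of square roots.\<close>
    have "\<bar>x $ i\<bar> \<le> 2 * a + 1" for i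
    proof -
      have "\<bar>(x $ i)\<^sup>2 - a\<bar> \<le> a"
        using comp[OF x, of i] less a0 abs_le_square_iff[of "(x $ i)\<^sup>2 - a" a] by linarith
      then have "\<bar>x $ i\<bar>\<^sup>2 \<le> 2 * a" by simp
      moreover have "2 * \<bar>x $ i\<bar> \<le> \<bar>x $ i\<bar>\<^sup>2 + 1"
        using zero_le_power2[of "\<bar>x $ i\<bar> - 1"] by (simp add: power2_eq_square algebra_simps)
      ultimately show ?thesis using a0 by linarith
    qed
    then have "(\<Sum>i\<in>UNIV. \<bar>x $ i\<bar>) \<le> (\<Sum>i\<in>(UNIV::'n set). 2 * a + 1)" by (intro sum_mono)
    with norm_le_l1_cart[of x] show "norm x \<le> (\<Sum>i\<in>(UNIV::'n set). 2 * a + 1)" by linarith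
  qed
  ultimately have "compact Q" by (simp add: compact_eq_bounded_closed)
  moreover have sv: "sqrt a *\<^sub>R v \<in> Q"
    using a0 by (auto simp: Q_def mult.left_commute[of _ "sqrt a"])
  ultimately obtain x where x: "x \<in> Q" and min: "\<And>y. y \<in> Q \<Longrightarrow> double_well a S x \<le> double_well a S y"
    using continuous_attains_inf[of Q "double_well a S"] continuous_on_double_well by blast
  have pos: "v $ i * x $ i > 0" for i
  proof -
    have "x $ i \<noteq> 0" using comp[OF x, of i] less by auto
    moreover have "v $ i \<noteq> 0" using spins_sq[OF v, of i] by auto
    moreover have "v $ i * x $ i \<ge> 0" using x by (auto simp: Q_def)
    ultimately show ?thesis by (simp add: order_less_le)
  qed
  define N where "N = (\<Inter>i. {y. 0 < v $ i * y $ i})"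
  have "open N" unfolding N_def
    by (intro open_INT ballI open_Collect_less continuous_intros) simp
  moreover have "x \<in> N" using pos by (simp add: N_def)
  \<comment> \<open>Points of \<open>N\<close> outside \<open>Q\<close> lie above the level of
    \<open>sqrt a *\<^sub>R v\<close>, which belongs to \<open>Q\<close> itself, so the minimum over
    \<open>Q\<close> is a minimum over the whole open orthant.\<close>
  moreover have "double_well a S x \<le> double_well a S y" if "y \<in> N" for y
  proof (cases "double_well a S y \<le> double_well a S (sqrt a *\<^sub>R v)")
    case True
    then have "y \<in> Q" using that by (auto simp: Q_def N_def intro: less_imp_le)
    then show ?thesis by (rule min)
  next
    case False
    then show ?thesis using min[OF sv] by linarith
  qed
  ultimately have "local_min_point (double_well a S) x"
    unfolding local_min_point_def eventually_nhds by blast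
  moreover have "sgn_vec x = v"
  proof -
    have "sgn (x $ i) = v $ i" for i
      using pos[of i] v by (auto simp: spins_def zero_less_mult_iff sgn_if dest!: spec[of _ i])
    then show ?thesis by (simp add: sgn_vec_def vec_eq_iff)
  qed
  ultimately show ?thesis by blast
qed

lemma sgn_vec_in_spins: "(\<And>i. x $ i \<noteq> 0) \<Longrightarrow> sgn_vec x \<in> spins"
  by (auto simp: sgn_vec_def spins_def sgn_if)

text \<open>The sublevel bound keeps \<open>x\<close> within the fixed distance \<open>D\<close> of
  \<open>sqrt a\<close> times its sign vector, and sign vectors have norm \<open>m\<close>.
  Expanding the coupling around that point leaves an error of order \<open>sqrt a\<close> against a
  main term of order \<open>a\<close>.\<close>

lemma double_well_global_energy:
  fixes S :: "real ^ 'n ^ 'n"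
  assumes C: "C > 0" "\<And>x y. \<bar>x \<bullet> (S *v y)\<bar> \<le> C * norm x * norm y"
    and a: "a \<ge> C" and v: "v \<in> spins" and nz: "\<And>i. x $ i \<noteq> 0"
    and le: "double_well a S x \<le> double_well a S (sqrt a *\<^sub>R v)"
  defines "D \<equiv> sqrt (12 * C * real CARD('n))" and "m \<equiv> sqrt (real CARD('n))"
  shows "a * (v \<bullet> (S *v v)) \<le> a * (sgn_vec x \<bullet> (S *v sgn_vec x)) + sqrt a * (2 * C * m * D) + C * D\<^sup>2"
proof -
  let ?n = "real CARD('n)"
  define \<sigma> where "\<sigma> = sgn_vec x"
  define d where "d = x - sqrt a *\<^sub>R \<sigma>"
  have a0: "a > 0" using a C(1) by linarith
  have \<sigma>: "\<sigma> \<in> spins" unfolding \<sigma>_def using nz by (rule sgn_vec_in_spins)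
  have n\<sigma>: "norm \<sigma> = m"
    using norm_spins[OF \<sigma>] by (metis m_def norm_ge_zero real_sqrt_unique)
  \<comment> \<open>The factor \<open>\<bar>x $ i\<bar> + sqrt a\<close> of
    \<open>(x $ i)\<^sup>2 - a\<close> is at least \<open>sqrt a\<close>; dividing by it turns the
    O(a) sublevel bound into a bound on \<open>d\<close> independent of \<open>a\<close>.\<close>
  have "a * (d $ i)\<^sup>2 \<le> ((x $ i)\<^sup>2 - a)\<^sup>2" for i
  proof -
    have "(d $ i)\<^sup>2 = (\<bar>x $ i\<bar> - sqrt a)\<^sup>2"
      using nz[of i] by (auto simp: d_def \<sigma>_def sgn_vec_def sgn_if power2_eq_square algebra_simps)
    moreover have "((x $ i)\<^sup>2 - a)\<^sup>2 = (\<bar>x $ i\<bar> + sqrt a)\<^sup>2 * (\<bar>x $ i\<bar> - sqrt a)\<^sup>2"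
    proof -
      have "(x $ i)\<^sup>2 - a = (\<bar>x $ i\<bar> + sqrt a) * (\<bar>x $ i\<bar> - sqrt a)"
        using a0 by (simp add: algebra_simps power2_eq_square)
      then show ?thesis by (simp add: power_mult_distrib)
    qed
    moreover have "(sqrt a)\<^sup>2 \<le> (\<bar>x $ i\<bar> + sqrt a)\<^sup>2"
      using a0 by (intro power_mono) auto
    ultimately show ?thesis using a0 by (auto intro!: mult_right_mono)
  qed
  then have "a * (norm d)\<^sup>2 \<le> (\<Sum>i\<in>UNIV. ((x $ i)\<^sup>2 - a)\<^sup>2)"
    unfolding power2_norm_vec sum_distrib_left by (intro sum_mono)
  also have "\<dots> \<le> 12 * C * ?n * a" using double_well_sublevel_bound[OF C a v le] .
  finally have "(norm d)\<^sup>2 \<le> 12 * C * ?n" using a0 by (simp add: mult.commute)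
  then have nd: "norm d \<le> D" unfolding D_def by (rule real_le_rsqrt)
  have m0: "m \<ge> 0" by (simp add: m_def)
  have b: "\<bar>y \<bullet> (S *v z)\<bar> \<le> C * r * s" if "norm y \<le> r" "norm z \<le> s" for y z r s
  proof -
    have "norm y * norm z \<le> r * s" using that norm_ge_zero[of y] norm_ge_zero[of z]
      by (intro mult_mono) linarith+
    then have "C * (norm y * norm z) \<le> C * (r * s)" using C(1) by simp
    then show ?thesis using C(2)[of y z] by (simp add: mult.assoc)
  qed
  have x: "x = sqrt a *\<^sub>R \<sigma> + d" by (simp add: d_def)
  have "x \<bullet> (S *v x) = a * (\<sigma> \<bullet> (S *v \<sigma>)) + sqrt a * (\<sigma> \<bullet> (S *v d) + d \<bullet> (S *v \<sigma>)) + d \<bullet> (S *v d)"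
    unfolding x using a0
    by (simp add: algebra_simps matrix_vector_right_distrib matrix_vector_mult_scaleR inner_add_left inner_add_right)
  also have "\<dots> \<le> a * (\<sigma> \<bullet> (S *v \<sigma>)) + sqrt a * (2 * C * m * D) + C * D\<^sup>2"
  proof -
    have "\<sigma> \<bullet> (S *v d) + d \<bullet> (S *v \<sigma>) \<le> 2 * C * m * D"
      using b[of \<sigma> m d D] b[of d D \<sigma> m] n\<sigma> nd by (simp add: mult_ac)
    then have "sqrt a * (\<sigma> \<bullet> (S *v d) + d \<bullet> (S *v \<sigma>)) \<le> sqrt a * (2 * C * m * D)"
      using a0 by (intro mult_left_mono) auto
    moreover have "d \<bullet> (S *v d) \<le> C * D\<^sup>2" using b[OF nd nd] by (simp add: power2_eq_square mult_ac)
    ultimately show ?thesis by linarith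
  qed
  finally have "x \<bullet> (S *v x) \<le> a * (\<sigma> \<bullet> (S *v \<sigma>)) + sqrt a * (2 * C * m * D) + C * D\<^sup>2" .
  \<comment> \<open>Dropping the nonnegative wells bounds the energy of \<open>x\<close> below by
    its coupling alone, while the wells vanish at \<open>sqrt a *\<^sub>R v\<close>.\<close>
  moreover have "a * (v \<bullet> (S *v v)) \<le> x \<bullet> (S *v x)"
  proof -
    have "- (1 / 2) * (x \<bullet> (S *v x)) \<le> double_well a S x" by (simp add: double_well_def sum_nonneg)
    also note le
    finally show ?thesis unfolding double_well_scaled_spin[OF v less_imp_le[OF a0]] by simp
  qed
  ultimately show ?thesis unfolding \<sigma>_def by linarith
qed

section \<open>Existence of an admissible threshold\<close>

lemma admissible_threshold_exists:
  fixes S :: "real ^ 'n ^ 'n"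
  assumes diag: "\<forall>i. S $ i $ i = 0"
  shows "\<exists>\<alpha>\<^sub>0. admissible_threshold \<beta> S \<alpha>\<^sub>0"
proof -
  let ?n = "real CARD('n)"
  obtain C where C: "C > 0" "\<And>x y. \<bar>x \<bullet> (S *v y)\<bar> \<le> C * norm x * norm y"
    using matrix_quadratic_form_bound[of S] by blast
  define D where "D = sqrt (12 * C * ?n)"
  define m where "m = sqrt ?n"
  \<comment> \<open>The first condition yields a minimum in every orthant, the second the sublevel
    estimate, and the third lets every strict difference of coupling energies outweigh the error of
    order \<open>sqrt a\<close>.\<close>
  define good where "good a \<longleftrightarrow> a > 12 * C * ?n \<and> a \<ge> C \<and> (\<forall>\<sigma>\<in>spins. \<forall>v\<in>spins. \<sigma> \<bullet> (S *v \<sigma>) < v \<bullet> (S *v v) \<longrightarrow>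
      a * (\<sigma> \<bullet> (S *v \<sigma>)) + sqrt a * (2 * C * m * D) + C * D\<^sup>2 < a * (v \<bullet> (S *v v)))" for a
  have gap: "\<forall>\<^sub>F a in at_top. a * p + sqrt a * q + r < a * p'" if "p < p'" for p p' q r :: real
  proof -
    have "\<forall>\<^sub>F a in at_top. sqrt a * q + r < a * (p' - p)"
      using that by real_asymp
    then show ?thesis by eventually_elim (simp add: algebra_simps)
  qed
  \<comment> \<open>Only finitely many pairs of spin vectors occur, so one lower bound on
    \<open>a\<close> serves all of them.\<close>
  have "\<forall>\<^sub>F a in at_top. good a"
    unfolding good_def
    by (intro eventually_conj eventually_gt_at_top eventually_ge_at_top eventually_ball_finite
        finite_spins ballI) (auto intro: gap)
  moreover have "filterlim (\<lambda>\<alpha>::real. \<alpha>\<^sup>2 - \<beta>) at_top at_top" by real_asymp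
  ultimately have "\<forall>\<^sub>F \<alpha> in at_top. good (\<alpha>\<^sup>2 - \<beta>)"
    by (rule eventually_compose_filterlim)
  then obtain A where A: "\<And>\<alpha>. \<alpha> \<ge> A \<Longrightarrow> good (\<alpha>\<^sup>2 - \<beta>)"
    unfolding eventually_at_top_linorder by blast
  \<comment> \<open>The 1 makes the threshold positive whatever the sign of
    \<open>A\<close>.\<close>
  have "admissible_threshold \<beta> S (max A 1)"
    unfolding admissible_threshold_def
  proof (intro conjI allI impI)
    fix \<alpha> assume \<alpha>: "\<alpha> > max A 1"
    define a where "a = \<alpha>\<^sup>2 - \<beta>"
    have g: "good a" using A[of \<alpha>] \<alpha> by (simp add: a_def)
    have a0: "a > 0" using g C(1) by (auto simp: good_def)
    have loc: "local_min_point (quartic_potential \<alpha> \<beta> S) x \<longleftrightarrow> local_min_point (double_well a S) x" for x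
      by (simp add: local_min_point_def quartic_potential_eq_double_well a_def)
    show "sgn_vec ` {x. local_min_point (quartic_potential \<alpha> \<beta> S) x} = spins"
    proof (intro equalityI subsetI)
      fix v assume "v \<in> sgn_vec ` {x. local_min_point (quartic_potential \<alpha> \<beta> S) x}"
      then show "v \<in> spins"
        using local_min_double_well_nonzero[OF _ a0] diag by (auto simp: loc intro!: sgn_vec_in_spins)
    next
      fix v :: "real ^ 'n" assume "v \<in> spins"
      then show "v \<in> sgn_vec ` {x. local_min_point (quartic_potential \<alpha> \<beta> S) x}"
        using double_well_orthant_minimum[OF C, of a v] g by (auto simp: good_def loc)
    qed
    fix x assume "global_min_point (quartic_potential \<alpha> \<beta> S) x"
    then have min: "double_well a S x \<le> double_well a S y" for y
      by (auto simp: is_arg_min_def quartic_potential_eq_double_well a_def not_less)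
    then have "local_min_point (double_well a S) x" by (simp add: local_min_point_def)
    then have nz: "x $ i \<noteq> 0" for i
      using local_min_double_well_nonzero[OF _ a0] diag by blast
    have \<sigma>: "sgn_vec x \<in> spins" using nz by (rule sgn_vec_in_spins)
    \<comment> \<open>If the sign vector had strictly smaller coupling than \<open>v\<close>, the
      third condition of \<open>good\<close> would contradict the energy comparison.\<close>
    have "v \<bullet> (S *v v) \<le> sgn_vec x \<bullet> (S *v sgn_vec x)" if v: "v \<in> spins" for v
      using double_well_global_energy[OF C _ v nz min, folded D_def m_def] g v \<sigma>
      unfolding good_def by (meson leD linorder_le_less_linear)
    then show "is_arg_min (ising_energy S) (\<lambda>v. v \<in> spins) (sgn_vec x)"
      using \<sigma> by (auto simp: is_arg_min_def ising_energy_def not_less)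
  qed simp
  then show ?thesis ..
qed

subsection \<open>Critical points and Morse index under adding a quadratic form\<close>

lemma GDERIV_unique:
  assumes "GDERIV f x :> D" and "GDERIV f x :> E"
  shows "D = E"
proof -
  have "(\<lambda>h. h \<bullet> D) = (\<lambda>h. h \<bullet> E)"
    using assms unfolding gderiv_def by (rule has_derivative_unique)
  then have "(D - E) \<bullet> (D - E) = 0" by (metis cancel_comm_monoid_add_class.diff_cancel inner_diff_right)
  then show ?thesis by simp
qed

lemma gradient_eqI: "GDERIV f x :> D \<Longrightarrow> gradient f x = D"
  unfolding gradient_def by (rule the_equality) (assumption, erule (1) GDERIV_unique)

lemma critical_points_gradient:
  assumes "\<And>x. GDERIV f x :> g x"
  shows "critical_points f = {x. g x = 0}"
proof -
  have "GDERIV f x :> 0 \<longleftrightarrow> g x = 0" for x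
    using GDERIV_unique[OF assms[of x], of 0] assms[of x] by metis
  then show ?thesis by (simp add: critical_points_def)
qed

text \<open>The gradient is given at all points because \<open>hessian\<close> differentiates
  \<open>gradient f\<close> as a function; the derivative of \<open>g\<close> matters at
  \<open>x\<close> only.\<close>

lemma hessian_eqI:
  assumes "\<And>x. GDERIV f x :> g x" and "(g has_derivative L) (at x)"
  shows "hessian f x = L"
proof -
  have "gradient f = g" by (intro ext gradient_eqI assms(1))
  then show ?thesis using frechet_derivative_at[OF assms(2)] by (simp add: hessian_def)
qed

lemma GDERIV_add_quadratic:
  fixes f :: "'a::euclidean_space \<Rightarrow> real" and y :: "'b::euclidean_space"
  assumes "GDERIV f x :> D"
  shows "GDERIV (\<lambda>(x, y). c / 2 * (y \<bullet> y) + f x) (x, y) :> (D, c *\<^sub>R y)"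
proof -
  have f: "(f has_derivative (\<lambda>h. h \<bullet> D)) (at (fst (x, y)))"
    using assms by (simp add: gderiv_def)
  have *: "((\<lambda>z. f (fst z)) has_derivative (\<lambda>h. fst h \<bullet> D)) (at (x, y))"
    by (rule has_derivative_compose[where f = fst, OF _ f]) (auto intro!: derivative_eq_intros)
  have "((\<lambda>z. c / 2 * (snd z \<bullet> snd z) + f (fst z)) has_derivative
      (\<lambda>h. h \<bullet> (D, c *\<^sub>R y))) (at (x, y))"
    by (rule * derivative_eq_intros refl)+ (auto simp: inner_commute algebra_simps)
  then show ?thesis by (simp add: gderiv_def case_prod_unfold)
qed

text \<open>The Hessian of \<open>F\<close> is block diagonal with blocks \<open>L\<close> and
  \<open>c\<close> times the identity, and the second block is positive definite. It does not depend
  on \<open>y\<close>, so the index identity holds at every \<open>y\<close>.\<close>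

lemma
  fixes f :: "'a::euclidean_space \<Rightarrow> real" and y :: "'b::euclidean_space"
  assumes g: "\<And>x. GDERIV f x :> g x" and "c > 0"
  defines "F \<equiv> \<lambda>(x, y :: 'b). c / 2 * (y \<bullet> y) + f x"
  shows critical_points_add_quadratic: "critical_points F = critical_points f \<times> {0}"
    and morse_index_add_quadratic:
      "(g has_derivative L) (at x) \<Longrightarrow> morse_index F (x, y) = morse_index f x"
proof -
  define G where "G = (\<lambda>(x, y :: 'b). (g x, c *\<^sub>R y))"
  have G: "GDERIV F z :> G z" for z
    using GDERIV_add_quadratic[OF g] by (cases z) (simp add: F_def G_def)
  show "critical_points F = critical_points f \<times> {0}"
    using \<open>c > 0\<close> by (auto simp: critical_points_gradient[OF G] critical_points_gradient[OF g]
        G_def zero_prod_def)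
  assume L: "(g has_derivative L) (at x)"
  have hf: "hessian f x = L" by (rule hessian_eqI[OF g L])
  define M where "M = (\<lambda>(u, w :: 'b). (L u, c *\<^sub>R w))"
  have L': "(g has_derivative L) (at (fst (x, y)))" using L by simp
  have *: "((\<lambda>z. g (fst z)) has_derivative (\<lambda>h. L (fst h))) (at (x, y))"
    by (rule has_derivative_compose[where f = fst, OF _ L']) (auto intro!: derivative_eq_intros)
  have "(G has_derivative M) (at (x, y))"
    unfolding G_def M_def case_prod_unfold
    by (rule * derivative_eq_intros refl)+ auto
  then have hF: "hessian F (x, y) = M" by (rule hessian_eqI[OF G])
  \<comment> \<open>Since \<open>\<mu> < 0 < c\<close>, the second component of an eigenvector must
    vanish.\<close>
  have es: "eigenspace M \<mu> = (\<lambda>u. (u, 0)) ` eigenspace L \<mu>" if "\<mu> < 0" for \<mu>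
  proof -
    have "c *\<^sub>R w = \<mu> *\<^sub>R w \<longleftrightarrow> w = 0" for w :: 'b
      using that \<open>c > 0\<close> by auto
    then have "(u, w) \<in> eigenspace M \<mu> \<longleftrightarrow> u \<in> eigenspace L \<mu> \<and> w = 0" for u w
      by (simp add: eigenspace_def M_def)
    then show ?thesis by (simp add: set_eq_iff split_paired_all image_iff conj_commute)
  qed
  \<comment> \<open>Reading eigenvalues off eigenspaces lets \<open>es\<close> transfer the negative
    spectrum as well as the dimensions.\<close>
  have evs: "\<mu> \<in> eigenvalues A \<longleftrightarrow> \<not> eigenspace A \<mu> \<subseteq> {0}"
    for A :: "'c::real_vector \<Rightarrow> 'c" and \<mu>
    by (auto simp: eigenvalues_def eigenspace_def)
  have "\<mu> \<in> eigenvalues M \<and> \<mu> < 0 \<longleftrightarrow> \<mu> \<in> eigenvalues L \<and> \<mu> < 0" for \<mu>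
    unfolding evs by (auto simp: es zero_prod_def image_subset_iff)
  moreover have "dim (eigenspace M \<mu>) = dim (eigenspace L \<mu>)" if "\<mu> < 0" for \<mu>
  proof -
    have lin: "linear (\<lambda>u :: 'a. (u, 0 :: 'b))"
      by (rule linearI) auto
    have "inj_on (\<lambda>u :: 'a. (u, 0 :: 'b)) A" for A by (auto intro: inj_onI)
    then show ?thesis unfolding es[OF that] by (intro dim_image_eq lin)
  qed
  ultimately show "morse_index F (x, y) = morse_index f x"
    unfolding morse_index_def hf hF by (intro sum.cong) auto
qed

section \<open>Gradient, Hessian and rescaling of \<open>U_h\<close>\<close>

lemma has_derivative_vec_nth: "((\<lambda>x. x $ i) has_derivative (\<lambda>h. h $ i)) F"
  by (rule bounded_linear.has_derivative[OF bounded_linear_vec_nth has_derivative_ident])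

lemma has_derivative_matrix_vector: "((\<lambda>x. (A :: real ^ 'n ^ 'm) *v x) has_derivative (\<lambda>h. A *v h)) F"
  by (rule bounded_linear.has_derivative[OF matrix_vector_mul_bounded_linear has_derivative_ident])

lemma has_derivative_vec_lambda:
  fixes f :: "'n::finite \<Rightarrow> 'a::real_normed_vector \<Rightarrow> real"
  assumes "\<And>i. (f i has_derivative f' i) (at x)"
  shows "((\<lambda>x. \<chi> i. f i x) has_derivative (\<lambda>h. \<chi> i. f' i h)) (at x)"
  unfolding has_derivative_componentwise_within[of "\<lambda>x. vec_lambda (\<lambda>i. f i x)"]
  using assms by (simp add: Basis_vec_def inner_axis)

text \<open>Symmetry of \<open>J\<close> makes the two terms of the product rule equal, which
  cancels the factor 1/2 of the coupling.\<close>

lemma GDERIV_U_h: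
  fixes J :: "real ^ 'n ^ 'n"
  assumes "transpose J = J"
  shows "GDERIV (U_h K \<Delta> \<xi> J p) x :>
    (\<chi> i. K * (x $ i) ^ 3 + (\<Delta> - p) * x $ i) - \<xi> *\<^sub>R (J *v x)"
proof -
  have sym: "x \<bullet> (J *v h) = h \<bullet> (J *v x)" for h
    by (metis assms dot_lmul_matrix inner_commute vector_transpose_matrix)
  have "DERIV (\<lambda>t. K / 4 * t ^ 4 + (\<Delta> - p) / 2 * t\<^sup>2) t :> K * t ^ 3 + (\<Delta> - p) * t" for t
    by (auto intro!: derivative_eq_intros simp: field_simps)
  then have *: "((\<lambda>x. \<Sum>i\<in>UNIV. K / 4 * (x $ i) ^ 4 + (\<Delta> - p) / 2 * (x $ i)\<^sup>2) has_derivative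
      (\<lambda>h. \<Sum>i\<in>UNIV. h $ i * (K * (x $ i) ^ 3 + (\<Delta> - p) * x $ i))) (at x)"
    by (intro has_derivative_sum DERIV_compose_FDERIV has_derivative_vec_nth)
  have "((\<lambda>x. x \<bullet> (J *v x)) has_derivative (\<lambda>h. x \<bullet> (J *v h) + h \<bullet> (J *v x))) (at x)"
    by (rule has_derivative_inner[OF has_derivative_ident has_derivative_matrix_vector])
  from has_derivative_diff[OF * has_derivative_mult_right[OF this, of "\<xi> / 2"]]
  show ?thesis
    unfolding gderiv_def U_h_def[abs_def]
    by (rule has_derivative_subst) (simp add: sym inner_diff_right inner_vec_def[of _ "vec_lambda _"])
qed

text \<open>Existence of the Hessian suffices: the comparison of Morse indices works for any
  derivative \<open>L\<close> of the gradient.\<close>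

lemma gradient_U_h_differentiable:
  fixes J :: "real ^ 'n ^ 'n"
  shows "(\<lambda>x. (\<chi> i. K * (x $ i) ^ 3 + a * x $ i) - \<xi> *\<^sub>R (J *v x)) differentiable at x"
proof -
  have "DERIV (\<lambda>t. K * t ^ 3 + a * t) t :> 3 * K * t\<^sup>2 + a" for t
    by (auto intro!: derivative_eq_intros)
  then have "((\<lambda>x. \<chi> i. K * (x $ i) ^ 3 + a * x $ i) has_derivative
      (\<lambda>h. \<chi> i. h $ i * (3 * K * (x $ i)\<^sup>2 + a))) (at x)"
    by (intro has_derivative_vec_lambda DERIV_compose_FDERIV has_derivative_vec_nth)
  from has_derivative_diff[OF this has_derivative_scaleR_right[OF has_derivative_matrix_vector]]
  show ?thesis by (rule differentiableI)
qed

text \<open>Scaling by \<open>sqrt K\<close> multiplies the quartic term by \<open>K\<^sup>2\<close>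
  and the quadratic forms by \<open>K\<close>; after division by \<open>K\<close> only the quartic
  term keeps a factor \<open>K\<close>. Taking \<open>\<alpha> = sqrt p\<close> makes
  \<open>\<alpha>\<^sup>2\<close> equal to \<open>p\<close>.\<close>

lemma U_h_rescale:
  fixes J :: "real ^ 'n ^ 'n"
  assumes "K > 0" and "p > 0"
  shows "U_h K \<Delta> \<xi> J p x = 1 / K * quartic_potential (sqrt p) \<Delta> (\<xi> *\<^sub>R J) (sqrt K *\<^sub>R x)"
proof -
  define Q where "Q = (\<Sum>i\<in>UNIV. (x $ i) ^ 4)"
  have K: "sqrt K * (sqrt K * y) = K * y" for y
    using assms(1) by (simp flip: mult.assoc)
  then have K4: "sqrt K ^ 4 = K\<^sup>2"
    by (simp add: power4_eq_xxxx power2_eq_square mult.assoc)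
  have "U_h K \<Delta> \<xi> J p x = K / 4 * Q + (\<Delta> - p) / 2 * (x \<bullet> x) - \<xi> / 2 * (x \<bullet> (J *v x))"
    by (simp add: U_h_def Q_def sum.distrib sum_distrib_left inner_vec_def[of x x] power2_eq_square)
  moreover have "(\<Sum>i\<in>UNIV. 1 / 4 * ((sqrt K *\<^sub>R x) $ i) ^ 4) = K\<^sup>2 / 4 * Q"
    by (simp add: Q_def sum_distrib_left power_mult_distrib K4)
  then have "quartic_potential (sqrt p) \<Delta> (\<xi> *\<^sub>R J) (sqrt K *\<^sub>R x) =
      K\<^sup>2 / 4 * Q + (\<Delta> - p) / 2 * (K * (x \<bullet> x)) - 1 / 2 * (\<xi> * (K * (x \<bullet> (J *v x))))"
    unfolding quartic_potential_def using assms(2)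
    by (simp only: matrix_vector_mult_scaleR scaleR_matrix_vector_assoc[symmetric] inner_scaleR_left
        inner_scaleR_right K mult.left_commute[of _ \<xi>] real_sqrt_pow2 less_imp_le)
  ultimately show ?thesis
    using assms(1) by (simp only:) (simp add: field_simps power2_eq_square)
qed

lemma sgn_vec_scaleR: "c > 0 \<Longrightarrow> sgn_vec (c *\<^sub>R x) = sgn_vec x"
  by (simp add: sgn_vec_def vec_eq_iff sgn_mult)

lemma ising_energy_scaleR: "ising_energy (c *\<^sub>R S) v = c * ising_energy S v"
  by (simp only: ising_energy_def scaleR_matrix_vector_assoc[symmetric] inner_scaleR_right mult.left_commute)

lemma H_s_eq:
  fixes J :: "real ^ 'n ^ 'n"
  shows "H_s K \<Delta> \<xi> J p = (\<lambda>(x, y). \<Delta> / 2 * (y \<bullet> y) + U_h K \<Delta> \<xi> J p x)"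
proof -
  have "(\<Sum>i\<in>UNIV. \<Delta> / 2 * (y $ i)\<^sup>2) = \<Delta> / 2 * (y \<bullet> y)" for y :: "real ^ 'n"
    by (simp only: inner_vec_def inner_real_def power2_eq_square sum_distrib_left)
  then show ?thesis by (simp only: H_s_def)
qed

section \<open>From \<open>H_s\<close> to \<open>U_h\<close> and on to the Ising problem\<close>

theorem proposition3p7:
  fixes J :: "real ^ 'n ^ 'n" and K \<Delta> \<xi>\<^sub>0 :: real
  assumes "transpose J = J"
    and "\<forall>i. J $ i $ i = 0"
    and "K > 0" and "\<Delta> > 0" and "\<xi>\<^sub>0 > 0"
  shows "\<exists>\<alpha>\<^sub>0. admissible_threshold \<Delta> (\<xi>\<^sub>0 *\<^sub>R J) \<alpha>\<^sub>0 \<and>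
    (\<forall>p>0. p > max (\<alpha>\<^sub>0\<^sup>2) (Max (eigenvalues (\<lambda>v. J *v v))) \<longrightarrow>
      (\<forall>x y. (x, y) \<in> critical_points (H_s K \<Delta> \<xi>\<^sub>0 J p) \<longrightarrow> y = 0) \<and>
      bij_betw fst (critical_points (H_s K \<Delta> \<xi>\<^sub>0 J p)) (critical_points (U_h K \<Delta> \<xi>\<^sub>0 J p)) \<and>
      (\<forall>x y. (x, y) \<in> critical_points (H_s K \<Delta> \<xi>\<^sub>0 J p) \<longrightarrow>
         morse_index (H_s K \<Delta> \<xi>\<^sub>0 J p) (x, y) = morse_index (U_h K \<Delta> \<xi>\<^sub>0 J p) x) \<and>
      (\<forall>x y. global_min_point (H_s K \<Delta> \<xi>\<^sub>0 J p) (x, y) \<longrightarrow>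
         is_arg_min (ising_energy J) (\<lambda>v. v \<in> spins) (sgn_vec x)))"
proof -
  \<comment> \<open>The threshold is fixed before \<open>p\<close>; scaling by
    \<open>\<xi>\<^sub>0\<close> keeps the diagonal zero.\<close>
  obtain \<alpha>\<^sub>0 where \<alpha>\<^sub>0: "admissible_threshold \<Delta> (\<xi>\<^sub>0 *\<^sub>R J) \<alpha>\<^sub>0"
    using admissible_threshold_exists[of "\<xi>\<^sub>0 *\<^sub>R J" \<Delta>] assms(2) by auto
  show ?thesis
  proof (intro exI[of _ \<alpha>\<^sub>0] conjI \<alpha>\<^sub>0 allI impI)
    fix p :: real
    assume p: "p > 0" "p > max (\<alpha>\<^sub>0\<^sup>2) (Max (eigenvalues (\<lambda>v. J *v v)))"
    note grad = GDERIV_U_h[OF assms(1), of K \<Delta> \<xi>\<^sub>0 p]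
    have crit: "critical_points (H_s K \<Delta> \<xi>\<^sub>0 J p) = critical_points (U_h K \<Delta> \<xi>\<^sub>0 J p) \<times> {0}"
      unfolding H_s_eq by (rule critical_points_add_quadratic[OF grad \<open>\<Delta> > 0\<close>])
    then show "bij_betw fst (critical_points (H_s K \<Delta> \<xi>\<^sub>0 J p)) (critical_points (U_h K \<Delta> \<xi>\<^sub>0 J p))"
      by (auto simp: bij_betw_def inj_on_def)
    fix x y :: "real ^ 'n"
    show "y = 0" if "(x, y) \<in> critical_points (H_s K \<Delta> \<xi>\<^sub>0 J p)"
      using that crit by simp
    show "morse_index (H_s K \<Delta> \<xi>\<^sub>0 J p) (x, y) = morse_index (U_h K \<Delta> \<xi>\<^sub>0 J p) x"
      using gradient_U_h_differentiable[of K "\<Delta> - p" \<xi>\<^sub>0 J x] unfolding H_s_eq differentiable_def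
      by (elim exE) (rule morse_index_add_quadratic[OF grad \<open>\<Delta> > 0\<close>])
    assume "global_min_point (H_s K \<Delta> \<xi>\<^sub>0 J p) (x, y)"
    \<comment> \<open>Comparing with points \<open>(x', y)\<close> that share \<open>y\<close>
      cancels the quadratic term.\<close>
    then have "U_h K \<Delta> \<xi>\<^sub>0 J p x \<le> U_h K \<Delta> \<xi>\<^sub>0 J p x'" for x'
      by (simp add: is_arg_min_def H_s_eq not_less) (metis add_le_cancel_left)
    then have min: "quartic_potential (sqrt p) \<Delta> (\<xi>\<^sub>0 *\<^sub>R J) (sqrt K *\<^sub>R x)
        \<le> quartic_potential (sqrt p) \<Delta> (\<xi>\<^sub>0 *\<^sub>R J) (sqrt K *\<^sub>R x')" for x'
      using \<open>K > 0\<close> p(1) by (simp add: U_h_rescale divide_le_cancel)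
    \<comment> \<open>Every \<open>z\<close> has the form \<open>sqrt K *\<^sub>R x'\<close>, so
      \<open>min\<close> covers the whole space.\<close>
    have "global_min_point (quartic_potential (sqrt p) \<Delta> (\<xi>\<^sub>0 *\<^sub>R J)) (sqrt K *\<^sub>R x)"
      using min[of "(1 / sqrt K) *\<^sub>R z" for z] \<open>K > 0\<close> by (auto simp: is_arg_min_def not_less)
    moreover have "sqrt p > \<alpha>\<^sub>0"
      using p(2) by (simp add: real_less_rsqrt)
    ultimately have "is_arg_min (ising_energy (\<xi>\<^sub>0 *\<^sub>R J)) (\<lambda>v. v \<in> spins) (sgn_vec (sqrt K *\<^sub>R x))"
      using \<alpha>\<^sub>0 unfolding admissible_threshold_def by blast
    \<comment> \<open>The positive factors \<open>sqrt K\<close> and \<open>\<xi>\<^sub>0\<close>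
      change neither component signs nor Ising minimizers.\<close>
    then show "is_arg_min (ising_energy J) (\<lambda>v. v \<in> spins) (sgn_vec x)"
      using \<open>K > 0\<close> \<open>\<xi>\<^sub>0 > 0\<close> by (simp add: is_arg_min_def sgn_vec_scaleR ising_energy_scaleR)
  qed
qed

end
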